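(* Let $n\geqslant 1$ and let $G=(V,E)$ be the bunkbed graph of the complete graph $K_n$. Then for all vertices $u,v\in V$ of the bottom graph and all $p\in[1/2,1]$, $$\mathbb{P}_{p}\left(u\leftrightarrow v\right)\geqslant\mathbb{P}_{p}\left(u\leftrightarrow v'\right),$$ where $v'$ is the symmetrical of $v$.
   Context: The bunkbed graph $G=(V,E)$ of a graph $\widetilde G=(\widetilde V,\widetilde E)$ has vertex set $V=\widetilde V\times\{0,1\}$ and edge set $$E=\{\{(x,0),(y,0)\}:\{x,y\}\in\widetilde E\}\cup\{\{(x,1),(y,1)\}:\{x,y\}\in\widetilde E\}\cup\{\{(x,0),(x,1)\}:x\in\widetilde V\}.$$ The vertices $(x,0)$ are the vertices of the bottom graph and the vertices $(x,1)$ those of the top graph. The symmetrical of a vertex $w=(x,i)$ is $w'=(x,1-i)$. Independent bond percolation $\mathbb{P}_p$ on $G$: each edge of $E$ is open with probability $p$ and closed with probability $1-p$, independently of the others. $a\leftrightarrow b$ denotes the event that there is a path of open edges between $a$ and $b$; by convention $a\leftrightarrow a$ always holds. *)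

theory Defs
  imports "HOL-Probability.Probability"
begin

text \<open>Undirected graphs as pairs of a vertex set and an edge set, edges being unordered pairs.\<close>

type_synonym 'a ugraph = "'a set \<times> 'a set set"

abbreviation vertices :: "'a ugraph \<Rightarrow> 'a set" where
  "vertices G \<equiv> fst G"

abbreviation edges :: "'a ugraph \<Rightarrow> 'a set set" where
  "edges G \<equiv> snd G"

definition complete_ugraph :: "nat \<Rightarrow> nat ugraph" where
  "complete_ugraph n = ({1..n}, {{x, y} | x y. x \<in> {1..n} \<and> y \<in> {1..n} \<and> x \<noteq> y})"

definition bunkbed :: "'a ugraph \<Rightarrow> ('a \<times> nat) ugraph" where
  "bunkbed G =
    (vertices G \<times> {0, 1},
     {{(x, 0), (y, 0)} | x y. {x, y} \<in> edges G} \<union>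
     {{(x, 1), (y, 1)} | x y. {x, y} \<in> edges G} \<union>
     {{(x, 0), (x, 1)} | x. x \<in> vertices G})"

text \<open>The truncated subtraction is harmless: the second component is only ever 0 or 1.\<close>

definition symmetrical :: "'a \<times> nat \<Rightarrow> 'a \<times> nat" where
  "symmetrical w = (fst w, 1 - snd w)"

text \<open>
  Independent bond percolation on a graph with finitely many edges. A configuration maps an edge
  to True iff it is open; sets that are not edges are mapped to False. For an infinite edge set
  \<^const>\<open>Pi_pmf\<close> would be meaningless.
\<close>

definition percolation :: "'a ugraph \<Rightarrow> real \<Rightarrow> ('a set \<Rightarrow> bool) pmf" where
  "percolation G p = Pi_pmf (edges G) False (\<lambda>_. bernoulli_pmf p)"

text \<open>A path is given by the list of the (pairwise distinct) vertices it visits.\<close>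

definition open_path :: "'a ugraph \<Rightarrow> ('a set \<Rightarrow> bool) \<Rightarrow> 'a \<Rightarrow> 'a list \<Rightarrow> 'a \<Rightarrow> bool" where
  "open_path G \<omega> a xs b \<longleftrightarrow>
     xs \<noteq> [] \<and> hd xs = a \<and> last xs = b \<and> distinct xs \<and>
     successively (\<lambda>x y. {x, y} \<in> edges G \<and> \<omega> {x, y}) xs"

text \<open>The event that a and b are joined by an open path; the path [a] accounts for a = b.\<close>

definition connected_event :: "'a ugraph \<Rightarrow> 'a \<Rightarrow> 'a \<Rightarrow> ('a set \<Rightarrow> bool) set" where
  "connected_event G a b = {\<omega>. \<exists>xs. open_path G \<omega> a xs b}"

lemma finite_edges_bunkbed_complete_ugraph: "finite (edges (bunkbed (complete_ugraph n)))"
proof (rule finite_subset)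
  show "edges (bunkbed (complete_ugraph n)) \<subseteq> Pow ({1..n} \<times> {0, 1})"
    by (auto simp: bunkbed_def complete_ugraph_def doubleton_eq_iff)
qed auto

lemma connected_event_refl: "connected_event G a a = UNIV"
proof -
  have "open_path G \<omega> a [a] a" for \<omega>
    by (simp add: open_path_def)
  then show ?thesis
    unfolding connected_event_def by blast
qed

end

theory Submission
  imports Defs
begin

text \<open>
  Write w(A, B) for the probability that A in the bottom layer together with B in the top layer is
  exactly one open cluster. Summing over the cluster of u and using w(A, B) = w(B, A), twice the
  difference of the two probabilities is the sum over all A, B avoiding u and v of
  w(A+u+v, B) + w(A, B+u+v) - w(A+u, B+v) - w(A+v, B+u), and every such term is nonnegative.
  Indeed, let q = 1 - p, let c be the number of common points of the two sets and let b be the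
  number of boundary edges of the cluster. The boundary must be closed and, if both layers are met,
  one of the c vertical edges inside must be open, so w is at most (1 - q^c) q^b. It is at least a
  quarter of this: for p at least 1/2 the percolation on a complete graph is connected with
  probability at least 1/2, because a graph or its complement is connected. Making the two
  layers less balanced lowers b by at least 2, which gains the factor q^2, at most 1/4.
\<close>

section \<open>Bernoulli products\<close>

abbreviation bernoulli_product :: "'e set \<Rightarrow> real \<Rightarrow> ('e \<Rightarrow> bool) pmf" where
  "bernoulli_product E p \<equiv> Pi_pmf E False (\<lambda>_. bernoulli_pmf p)"

text \<open>The event is determined by the coordinates in \<open>S\<close>. One implication is
  enough, because agreement on \<open>S\<close> is symmetric in the two configurations.\<close>

definition depends_on :: "('e \<Rightarrow> 'b) set \<Rightarrow> 'e set \<Rightarrow> bool" where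
  "depends_on X S \<longleftrightarrow> (\<forall>\<omega> \<omega>'. (\<forall>e\<in>S. \<omega> e = \<omega>' e) \<longrightarrow> \<omega> \<in> X \<longrightarrow> \<omega>' \<in> X)"

lemma depends_onD: "depends_on X S \<Longrightarrow> (\<And>e. e \<in> S \<Longrightarrow> \<omega> e = \<omega>' e) \<Longrightarrow> \<omega> \<in> X \<longleftrightarrow> \<omega>' \<in> X"
  unfolding depends_on_def by metis

lemma depends_on_mono: "depends_on X S \<Longrightarrow> S \<subseteq> T \<Longrightarrow> depends_on X T"
  unfolding depends_on_def by (meson subsetD)

lemma depends_on_Int: "depends_on X S \<Longrightarrow> depends_on Y T \<Longrightarrow> depends_on (X \<inter> Y) (S \<union> T)"
  unfolding depends_on_def by (metis IntE IntI UnCI)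

lemma prob_pair_pmf_Times:
  "measure_pmf.prob (pair_pmf M N) (X \<times> Y) = measure_pmf.prob M X * measure_pmf.prob N Y"
proof -
  \<comment> \<open>Cutting down to the supports makes both factors countable, as
    \<open>measure_pmf_prob_product\<close> requires.\<close>
  let ?X = "X \<inter> set_pmf M" and ?Y = "Y \<inter> set_pmf N"
  have "measure_pmf.prob (pair_pmf M N) (X \<times> Y) = measure_pmf.prob (pair_pmf M N) (?X \<times> ?Y)"
    by (subst measure_Int_set_pmf [symmetric]) (simp add: Times_Int_Times)
  also have "\<dots> = measure_pmf.prob M ?X * measure_pmf.prob N ?Y"
    by (rule measure_pmf_prob_product) (auto intro: countable_subset)
  finally show ?thesis
    by (simp add: measure_Int_set_pmf)
qed

text \<open>A configuration on \<open>E\<close> is glued from independent ones on \<open>S\<close>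
  and on \<open>E - S\<close>. Since \<open>T\<close> misses \<open>S\<close>, the event
  \<open>X\<close> reads only the first piece and \<open>Y\<close> only the second, so the
  intersection becomes a rectangle.\<close>

lemma prob_Pi_pmf_Int_indep:
  assumes "finite E" "depends_on X S" "depends_on Y T" "S \<inter> T = {}" "S \<subseteq> E"
  shows "measure_pmf.prob (Pi_pmf E d q) (X \<inter> Y)
           = measure_pmf.prob (Pi_pmf E d q) X * measure_pmf.prob (Pi_pmf E d q) Y"
proof -
  let ?h = "\<lambda>(f, g) e. if e \<in> S then f e else g e"
  let ?P = "pair_pmf (Pi_pmf S d q) (Pi_pmf (E - S) d q)"
  have "finite S"
    using assms finite_subset by blast
  then have "Pi_pmf E d q = map_pmf ?h ?P"
    using Pi_pmf_union [of S "E - S" d q] assms by (simp add: Un_absorb1)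
  then have prob: "measure_pmf.prob (Pi_pmf E d q) Z = measure_pmf.prob ?P (?h -` Z)" for Z
    by simp
  have hX: "?h (f, g) \<in> X \<longleftrightarrow> f \<in> X" for f g
    using assms(2) by (rule depends_onD) auto
  have hY: "?h (f, g) \<in> Y \<longleftrightarrow> g \<in> Y" for f g
    using assms(3) by (rule depends_onD) (use assms(4) in auto)
  have "?h -` (X \<inter> Y) = X \<times> Y" "?h -` X = X \<times> UNIV" "?h -` Y = UNIV \<times> Y"
    using hX hY by auto
  then show ?thesis
    by (simp add: prob prob_pair_pmf_Times)
qed

lemma prob_all_closed:
  assumes "finite E" "S \<subseteq> E" "0 \<le> p" "p \<le> 1"
  shows "measure_pmf.prob (bernoulli_product E p) {\<omega>. \<forall>e\<in>S. \<not> \<omega> e} = (1 - p) ^ card S"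
proof -
  let ?B = "\<lambda>e. if e \<in> S then {False} else UNIV"
  have "{\<omega>. \<forall>e\<in>S. \<not> \<omega> e} = Pi E ?B"
    using assms(2) by (auto simp: Pi_def split: if_splits)
  then have "measure_pmf.prob (bernoulli_product E p) {\<omega>. \<forall>e\<in>S. \<not> \<omega> e}
      = (\<Prod>e\<in>E. measure_pmf.prob (bernoulli_pmf p) (?B e))"
    using assms(1) by (simp add: measure_Pi_pmf_Pi)
  also have "\<dots> = (\<Prod>e\<in>E. if e \<in> S then 1 - p else 1)"
    using assms by (intro prod.cong) (auto simp: measure_pmf_single)
  also have "\<dots> = (1 - p) ^ card S"
    using assms by (simp add: prod.If_cases Int_absorb1)
  finally show ?thesis .
qed

lemma prob_some_open:
  assumes "finite E" "S \<subseteq> E" "0 \<le> p" "p \<le> 1"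
  shows "measure_pmf.prob (bernoulli_product E p) {\<omega>. \<exists>e\<in>S. \<omega> e} = 1 - (1 - p) ^ card S"
proof -
  have "{\<omega>. \<exists>e\<in>S. \<omega> e} = UNIV - {\<omega>. \<forall>e\<in>S. \<not> \<omega> e}"
    by auto
  then show ?thesis
    using measure_pmf.prob_compl [of "{\<omega>. \<forall>e\<in>S. \<not> \<omega> e}" "bernoulli_product E p"]
    by (simp add: prob_all_closed [OF assms])
qed

section \<open>Conditioning on one edge: monotonicity in the parameter and flipping all
  edges\<close>

lemma prob_bernoulli_product_insert:
  assumes "finite E" "e \<notin> E" "0 \<le> p" "p \<le> 1"
  shows "measure_pmf.prob (bernoulli_product (insert e E) p) X
           = p * measure_pmf.prob (bernoulli_product E p) {\<omega>. fun_upd \<omega> e True \<in> X}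
             + (1 - p) * measure_pmf.prob (bernoulli_product E p) {\<omega>. fun_upd \<omega> e False \<in> X}"
proof -
  let ?X = "\<lambda>b. {\<omega>. fun_upd \<omega> e (b) \<in> X}"
  let ?P = "pair_pmf (bernoulli_pmf p) (bernoulli_product E p)"
  have "(\<lambda>(y, f). f(e := y)) -` X = {True} \<times> ?X True \<union> {False} \<times> ?X False"
    by (auto split: if_splits) (metis (full_types))+
  then have "measure_pmf.prob (bernoulli_product (insert e E) p) X
      = measure_pmf.prob ?P ({True} \<times> ?X True \<union> {False} \<times> ?X False)"
    using assms by (simp add: Pi_pmf_insert)
  also have "\<dots> = measure_pmf.prob ?P ({True} \<times> ?X True) + measure_pmf.prob ?P ({False} \<times> ?X False)"
    by (rule measure_pmf.finite_measure_Union) auto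
  finally show ?thesis
    using assms by (simp add: prob_pair_pmf_Times measure_pmf_single)
qed

text \<open>Induction on the edges. For an up-set the section \<open>?F\<close> with
  \<open>e\<close> closed lies in the section \<open>?T\<close> with \<open>e\<close> open, so
  moving weight from closed to open can only help; the induction hypothesis then raises the
  parameter of the remaining edges.\<close>

lemma prob_upset_mono:
  assumes "finite E" "0 \<le> p" "p \<le> r" "r \<le> 1"
    and "\<And>\<omega> \<omega>'. \<omega> \<in> X \<Longrightarrow> \<omega> \<le> \<omega>' \<Longrightarrow> \<omega>' \<in> X"
  shows "measure_pmf.prob (bernoulli_product E p) X \<le> measure_pmf.prob (bernoulli_product E r) X"
  using assms(1,5)
proof (induction E arbitrary: X rule: finite_induct)
  case empty
  then show ?case by simp
next
  case (insert e E)
  let ?P = "\<lambda>s. measure_pmf.prob (bernoulli_product E s)"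
  let ?T = "{\<omega>. fun_upd \<omega> e True \<in> X}" and ?F = "{\<omega>. fun_upd \<omega> e False \<in> X}"
  have T: "?P p ?T \<le> ?P r ?T" and F: "?P p ?F \<le> ?P r ?F"
    by (rule insert.IH; use insert.prems in \<open>force simp: le_fun_def\<close>)+
  have "?F \<subseteq> ?T"
    using insert.prems by (force simp: le_fun_def)
  then have FT: "?P p ?F \<le> ?P p ?T"
    by (intro measure_pmf.finite_measure_mono) auto
  have "p * ?P p ?T + (1 - p) * ?P p ?F \<le> r * ?P p ?T + (1 - r) * ?P p ?F"
    using mult_nonneg_nonneg [of "r - p" "?P p ?T - ?P p ?F"] FT assms by (simp add: algebra_simps)
  also have "\<dots> \<le> r * ?P r ?T + (1 - r) * ?P r ?F"
    using T F assms by (intro add_mono mult_left_mono) auto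
  finally show ?case
    using insert.hyps assms by (simp add: prob_bernoulli_product_insert)
qed

text \<open>Open and closed trade places edge by edge. The flip also turns the default
  \<open>False\<close> outside \<open>E\<close> into \<open>True\<close>; the condition
  \<open>depends_on X E\<close> hides this difference and is what settles the empty edge
  set.\<close>

lemma prob_complement:
  assumes "finite E" "0 \<le> p" "p \<le> 1" "depends_on X E"
  shows "measure_pmf.prob (bernoulli_product E p) {\<omega>. (\<lambda>e. \<not> \<omega> e) \<in> X}
           = measure_pmf.prob (bernoulli_product E (1 - p)) X"
  using assms(1,4)
proof (induction E arbitrary: X rule: finite_induct)
  case empty
  then have "(\<lambda>_. True) \<in> X \<longleftrightarrow> (\<lambda>_. False) \<in> X"
    by (auto simp: depends_on_def)
  then show ?case by (simp add: indicator_def)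
next
  case (insert e E)
  let ?X = "\<lambda>b. {\<omega>. fun_upd \<omega> e (b) \<in> X}"
  have "depends_on (?X b) E" for b
    unfolding depends_on_def
  proof (intro allI impI)
    fix \<omega> \<omega>' assume "\<forall>e\<in>E. \<omega> e = \<omega>' e" "\<omega> \<in> ?X b"
    moreover from this have "fun_upd \<omega> e b \<in> X \<longleftrightarrow> fun_upd \<omega>' e b \<in> X"
      by (intro depends_onD [OF insert.prems]) auto
    ultimately show "\<omega>' \<in> ?X b" by simp
  qed
  then have IH: "measure_pmf.prob (bernoulli_product E p) {\<omega>. (\<lambda>e. \<not> \<omega> e) \<in> ?X b}
      = measure_pmf.prob (bernoulli_product E (1 - p)) (?X b)" for b
    by (rule insert.IH)
  have "(\<lambda>e'. \<not> (fun_upd \<omega> e b) e') = fun_upd (\<lambda>e'. \<not> \<omega> e') e (\<not> b)" for \<omega> b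
    by auto
  with IH have "measure_pmf.prob (bernoulli_product E p) {\<omega>. (\<lambda>e'. \<not> (fun_upd \<omega> e b) e') \<in> X}
      = measure_pmf.prob (bernoulli_product E (1 - p)) (?X (\<not> b))" for b
    by (simp only: mem_Collect_eq)
  then show ?case
    using insert.hyps assms by (simp add: prob_bernoulli_product_insert del: fun_upd_apply)
qed

section \<open>Open clusters\<close>

definition open_steps :: "'a set set \<Rightarrow> ('a set \<Rightarrow> bool) \<Rightarrow> ('a \<times> 'a) set" where
  "open_steps E \<omega> = {(x, y). {x, y} \<in> E \<and> \<omega> {x, y}}"

lemma sym_open_steps_rtrancl: "sym ((open_steps E \<omega>)\<^sup>*)"
  by (rule sym_rtrancl) (auto simp: sym_def open_steps_def insert_commute)

text \<open>The point is to keep the vertices distinct when a path is extended by one step: if the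
  new vertex was already visited, the path is cut off at that visit instead.\<close>

lemma connected_event_iff_rtrancl:
  "\<omega> \<in> connected_event G a b \<longleftrightarrow> (a, b) \<in> (open_steps (edges G) \<omega>)\<^sup>*"
proof
  have "(hd xs, last xs) \<in> (open_steps (edges G) \<omega>)\<^sup>*"
    if "xs \<noteq> []" "successively (\<lambda>x y. {x, y} \<in> edges G \<and> \<omega> {x, y}) xs" for xs
    using that
  proof (induction xs rule: induct_list012)
    case (3 x y zs)
    then have "(x, y) \<in> open_steps (edges G) \<omega>"
      by (simp add: open_steps_def)
    with 3 show ?case
      by (auto intro: converse_rtrancl_into_rtrancl)
  qed auto
  then show "(a, b) \<in> (open_steps (edges G) \<omega>)\<^sup>*" if "\<omega> \<in> connected_event G a b"
    using that by (auto simp: connected_event_def open_path_def)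
next
  assume "(a, b) \<in> (open_steps (edges G) \<omega>)\<^sup>*"
  then show "\<omega> \<in> connected_event G a b"
  proof (induction rule: rtrancl_induct)
    case base
    then show ?case by (simp add: connected_event_refl)
  next
    case (step b c)
    then obtain xs where xs: "open_path G \<omega> a xs b"
      by (auto simp: connected_event_def)
    show ?case
    proof (cases "c \<in> set xs")
      case True
      then obtain ys zs where eq: "xs = (ys @ [c]) @ zs"
        by (auto simp: in_set_conv_decomp)
      then have "successively (\<lambda>x y. {x, y} \<in> edges G \<and> \<omega> {x, y}) (ys @ [c])"
        using xs unfolding open_path_def successively_append_iff [of _ "ys @ [c]" zs] eq by blast
      then have "open_path G \<omega> a (ys @ [c]) c"
        using xs eq by (cases ys) (auto simp: open_path_def)
      then show ?thesis
        by (auto simp: connected_event_def)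
    next
      case False
      then have "open_path G \<omega> a (xs @ [c]) c"
        using xs step(2) by (auto simp: open_path_def open_steps_def successively_append_iff)
      then show ?thesis
        by (auto simp: connected_event_def)
    qed
  qed
qed

definition connects :: "'a set set \<Rightarrow> 'a set \<Rightarrow> ('a set \<Rightarrow> bool) set" where
  "connects E S = {\<omega>. \<forall>x\<in>S. \<forall>y\<in>S. (x, y) \<in> (open_steps E \<omega>)\<^sup>*}"

lemma open_steps_mono:
  "E \<subseteq> F \<Longrightarrow> (\<And>e. e \<in> E \<Longrightarrow> \<omega> e \<Longrightarrow> \<omega>' e) \<Longrightarrow> open_steps E \<omega> \<subseteq> open_steps F \<omega>'"
  by (auto simp: open_steps_def)

lemma depends_on_connects: "depends_on (connects E S) E"
proof -
  have "\<omega>' \<in> connects E S" if "\<forall>e\<in>E. \<omega> e = \<omega>' e" "\<omega> \<in> connects E S" for \<omega> \<omega>'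
  proof -
    have "open_steps E \<omega> = open_steps E \<omega>'"
      using that(1) by (auto simp: open_steps_def)
    with that(2) show ?thesis
      by (simp add: connects_def)
  qed
  then show ?thesis
    unfolding depends_on_def by blast
qed

lemma connects_upset:
  assumes "\<omega> \<in> connects E S" "\<omega> \<le> \<omega>'"
  shows "\<omega>' \<in> connects E S"
  using assms rtrancl_mono [OF open_steps_mono [of E E \<omega> \<omega>']]
  by (force simp: connects_def le_fun_def)

section \<open>Connectedness of percolation on a complete graph\<close>

definition complete_edges :: "'a set \<Rightarrow> 'a set set" where
  "complete_edges S = {{x, y} | x y. x \<in> S \<and> y \<in> S \<and> x \<noteq> y}"

lemma doubleton_in_complete_edges_iff:
  "{x, y} \<in> complete_edges S \<longleftrightarrow> x \<in> S \<and> y \<in> S \<and> x \<noteq> y"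
  by (auto simp: complete_edges_def doubleton_eq_iff)

text \<open>If the open graph is disconnected, the cluster of some \<open>x\<close> misses some
  \<open>y\<close>. Every edge between this cluster and its complement in \<open>S\<close> is
  closed, so the flipped configuration contains a complete bipartite graph with two nonempty sides,
  which is connected.\<close>

lemma complement_connects_complete_edges:
  assumes "\<omega> \<notin> connects (complete_edges S) S"
  shows "(\<lambda>e. \<not> \<omega> e) \<in> connects (complete_edges S) S"
proof -
  let ?R = "open_steps (complete_edges S) \<omega>" and ?R' = "open_steps (complete_edges S) (\<lambda>e. \<not> \<omega> e)"
  from assms obtain x y where xy: "x \<in> S" "y \<in> S" "(x, y) \<notin> ?R\<^sup>*"
    by (auto simp: connects_def)
  have across: "(a, b) \<in> ?R'" if "a \<in> S" "b \<in> S" "(x, a) \<in> ?R\<^sup>*" "(x, b) \<notin> ?R\<^sup>*" for a b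
  proof -
    have "(a, b) \<notin> ?R" "a \<noteq> b"
      using that by (auto intro: rtrancl_into_rtrancl)
    then show ?thesis
      using that by (auto simp: open_steps_def doubleton_in_complete_edges_iff)
  qed
  \<comment> \<open>A point on the side of \<open>x\<close> is reached through \<open>y\<close>, a
    point on the other side directly.\<close>
  have to_x: "(x, a) \<in> ?R'\<^sup>*" if "a \<in> S" for a
  proof (cases "(x, a) \<in> ?R\<^sup>*")
    case True
    then have "(x, y) \<in> ?R'" "(a, y) \<in> ?R'"
      using across that xy by auto
    then show ?thesis
      using sym_open_steps_rtrancl by (meson r_into_rtrancl rtrancl_trans symD)
  next
    case False
    then show ?thesis
      using across [of x a] that xy by auto
  qed
  have "(a, b) \<in> ?R'\<^sup>*" if "a \<in> S" "b \<in> S" for a b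
    using to_x [OF that(1)] to_x [OF that(2)] sym_open_steps_rtrancl
    by (meson rtrancl_trans symD)
  then show ?thesis
    by (simp add: connects_def)
qed

text \<open>Connectedness of the configuration and of its flip together cover everything. The flip
  has parameter \<open>1 - p\<close>, at most \<open>p\<close>, and connectedness is increasing, so
  the second event is no more likely than the first.\<close>

lemma prob_connects_complete_edges_ge_half:
  assumes "finite E" "complete_edges S \<subseteq> E" "1/2 \<le> p" "p \<le> 1"
  shows "measure_pmf.prob (bernoulli_product E p) (connects (complete_edges S) S) \<ge> 1/2"
proof -
  let ?X = "connects (complete_edges S) S"
  have "UNIV = ?X \<union> {\<omega>. (\<lambda>e. \<not> \<omega> e) \<in> ?X}"
    using complement_connects_complete_edges by auto
  then have "1 \<le> measure_pmf.prob (bernoulli_product E p) ?X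
      + measure_pmf.prob (bernoulli_product E p) {\<omega>. (\<lambda>e. \<not> \<omega> e) \<in> ?X}"
    using measure_Un_le [of ?X "bernoulli_product E p" "{\<omega>. (\<lambda>e. \<not> \<omega> e) \<in> ?X}"] by simp
  also have "measure_pmf.prob (bernoulli_product E p) {\<omega>. (\<lambda>e. \<not> \<omega> e) \<in> ?X}
      = measure_pmf.prob (bernoulli_product E (1 - p)) ?X"
    using assms by (intro prob_complement depends_on_mono [OF depends_on_connects]) auto
  also have "\<dots> \<le> measure_pmf.prob (bernoulli_product E p) ?X"
    using assms by (intro prob_upset_mono) (auto intro: connects_upset)
  finally show ?thesis by simp
qed

section \<open>The cluster of a vertex as an event\<close>

definition cluster_event :: "'a set set \<Rightarrow> 'a set \<Rightarrow> ('a set \<Rightarrow> bool) set" where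
  "cluster_event E C = {\<omega>. \<forall>x\<in>C. (open_steps E \<omega>)\<^sup>* `` {x} = C}"

lemma cluster_event_iff:
  assumes "u \<in> C"
  shows "\<omega> \<in> cluster_event E C \<longleftrightarrow> (open_steps E \<omega>)\<^sup>* `` {u} = C"
proof
  assume C: "(open_steps E \<omega>)\<^sup>* `` {u} = C"
  have "(x, y) \<in> (open_steps E \<omega>)\<^sup>* \<longleftrightarrow> (u, y) \<in> (open_steps E \<omega>)\<^sup>*" if "x \<in> C" for x y
    using that C sym_open_steps_rtrancl [of E \<omega>] by (auto dest: symD intro: rtrancl_trans)
  with C show "\<omega> \<in> cluster_event E C"
    by (auto simp: cluster_event_def)
qed (use assms in \<open>auto simp: cluster_event_def\<close>)

text \<open>Configurations are sorted by the cluster of \<open>u\<close>. The conditions on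
  \<open>C\<close> are factors rather than a restriction of the index set, so that the sum over
  \<open>Pow V\<close> can later be split by layers. The factor for \<open>u\<close> also removes
  the empty set, for which \<open>cluster_event\<close> is the sure event.\<close>

lemma prob_connected_event_eq_sum:
  assumes "finite (edges G)" "\<And>e. e \<in> edges G \<Longrightarrow> e \<subseteq> V" "finite V" "u \<in> V"
  shows "measure_pmf.prob (percolation G p) (connected_event G u v)
    = (\<Sum>C\<in>Pow V. of_bool (u \<in> C) * of_bool (v \<in> C)
         * measure_pmf.prob (percolation G p) (cluster_event (edges G) C))"
proof -
  let ?M = "percolation G p" and ?cl = "\<lambda>\<omega>. (open_steps (edges G) \<omega>)\<^sup>* `` {u}"
  let ?S = "{C \<in> Pow V. u \<in> C \<and> v \<in> C}"
  have "?cl \<omega> \<subseteq> V" for \<omega>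
  proof
    fix x assume "x \<in> ?cl \<omega>"
    then have "(u, x) \<in> (open_steps (edges G) \<omega>)\<^sup>*" by simp
    then show "x \<in> V"
      using assms by (induction rule: rtrancl_induct) (auto simp: open_steps_def)
  qed
  then have "connected_event G u v = (\<Union>C\<in>?S. cluster_event (edges G) C)"
    by (auto simp: connected_event_iff_rtrancl cluster_event_iff [of u])
  moreover have "disjoint_family_on (cluster_event (edges G)) ?S"
    by (auto simp: disjoint_family_on_def cluster_event_iff [of u])
  ultimately have "measure_pmf.prob ?M (connected_event G u v)
      = (\<Sum>C\<in>?S. measure_pmf.prob ?M (cluster_event (edges G) C))"
    using assms by (simp add: measure_pmf.finite_measure_finite_Union)
  also have "\<dots> = (\<Sum>C\<in>Pow V. of_bool (u \<in> C) * of_bool (v \<in> C)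
      * measure_pmf.prob ?M (cluster_event (edges G) C))"
    using assms by (intro sum.mono_neutral_cong_left) auto
  finally show ?thesis .
qed

section \<open>Cluster probabilities in the bunkbed graph\<close>

text \<open>Bottom, top and vertical edges are told apart by the set of layers that they
  meet.\<close>

lemma disjoint_by_layers:
  "(\<And>e. e \<in> S \<Longrightarrow> snd ` e = I) \<Longrightarrow> (\<And>e. e \<in> T \<Longrightarrow> snd ` e = J) \<Longrightarrow> I \<noteq> J \<Longrightarrow> S \<inter> T = {}"
  by (metis disjoint_iff)

section \<open>Edge boundaries and their sizes\<close>

definition edge_boundary :: "'a set set \<Rightarrow> 'a set \<Rightarrow> 'a set set" where
  "edge_boundary E C = {e \<in> E. \<exists>x y. e = {x, y} \<and> x \<in> C \<and> y \<notin> C}"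

lemma edge_boundary_not_subset: "e \<in> edge_boundary E C \<Longrightarrow> \<not> e \<subseteq> C"
  by (auto simp: edge_boundary_def)

lemma cluster_event_boundary_closed:
  assumes "\<omega> \<in> cluster_event E C" "e \<in> edge_boundary E C"
  shows "\<not> \<omega> e"
proof
  assume "\<omega> e"
  moreover obtain x y where xy: "e \<in> E" "e = {x, y}" "x \<in> C" "y \<notin> C"
    using assms(2) by (auto simp: edge_boundary_def)
  ultimately have "(x, y) \<in> (open_steps E \<omega>)\<^sup>*"
    by (auto simp: open_steps_def)
  with xy assms(1) show False
    by (auto simp: cluster_event_def)
qed

lemma cluster_eventI:
  assumes "\<And>e. e \<in> edge_boundary E C \<Longrightarrow> \<not> \<omega> e" "\<omega> \<in> connects E C"
  shows "\<omega> \<in> cluster_event E C"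
proof -
  have "y \<in> C" if "(x, y) \<in> (open_steps E \<omega>)\<^sup>*" "x \<in> C" for x y
    using that
  proof (induction rule: rtrancl_induct)
    case (step y z)
    then show ?case
      using assms(1) [of "{y, z}"] by (auto simp: open_steps_def edge_boundary_def)
  qed
  then show ?thesis
    using assms(2) by (auto simp: cluster_event_def connects_def)
qed

text \<open>An arbitrary vertex set \<open>N\<close> instead of \<open>{1..n}\<close> allows the two
  marked points to be split off with \<open>insert\<close>.\<close>

definition bunkbed_edges :: "'a set \<Rightarrow> ('a \<times> nat) set set" where
  "bunkbed_edges N = edges (bunkbed (N, complete_edges N))"

lemma doubleton_in_bunkbed_edges_iff:
  "{(x, i), (y, j)} \<in> bunkbed_edges N \<longleftrightarrow>
     x \<in> N \<and> y \<in> N \<and> (x \<noteq> y \<and> i = j \<and> i \<in> {0, 1} \<or> x = y \<and> {i, j} = {0, 1})"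
  by (auto simp: bunkbed_edges_def bunkbed_def doubleton_in_complete_edges_iff doubleton_eq_iff)

lemma bunkbed_edges_cases:
  assumes "e \<in> bunkbed_edges N"
  obtains x y i where "e = {(x, i), (y, i)}" "x \<in> N" "y \<in> N" "x \<noteq> y" "i \<in> {0, 1}"
    | x where "e = {(x, 0), (x, 1)}" "x \<in> N"
  using assms by (auto simp: bunkbed_edges_def bunkbed_def doubleton_in_complete_edges_iff)

lemma bunkbed_edges_subset: "e \<in> bunkbed_edges N \<Longrightarrow> e \<subseteq> N \<times> {0, 1}"
  by (erule bunkbed_edges_cases) auto

lemma finite_bunkbed_edges: "finite N \<Longrightarrow> finite (bunkbed_edges N)"
  by (rule finite_subset [of _ "Pow (N \<times> {0, 1})"]) (use bunkbed_edges_subset in auto)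

lemma complete_edges_layer_subset:
  assumes "A \<subseteq> N" "i = 0 \<or> i = 1"
  shows "complete_edges (A \<times> {i}) \<subseteq> bunkbed_edges N"
proof
  fix e assume "e \<in> complete_edges (A \<times> {i})"
  then obtain x y where "e = {(x, i), (y, i)}" "x \<in> A" "y \<in> A" "x \<noteq> y"
    by (auto simp: complete_edges_def)
  then show "e \<in> bunkbed_edges N"
    using assms by (auto simp: doubleton_in_bunkbed_edges_iff)
qed

definition two_layers :: "'a set \<Rightarrow> 'a set \<Rightarrow> ('a \<times> nat) set" where
  "two_layers A B = A \<times> {0} \<union> B \<times> {1}"

definition vertical :: "'a set \<Rightarrow> ('a \<times> nat) set set" where
  "vertical A = (\<lambda>x. {(x, 0), (x, 1)}) ` A"

lemma card_vertical: "card (vertical A) = card A"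
  unfolding vertical_def by (rule card_image) (auto simp: inj_on_def doubleton_eq_iff)

text \<open>The products count the horizontal boundary edges in the two layers, the symmetric
  difference the vertical ones.\<close>

definition boundary_size :: "nat \<Rightarrow> 'a set \<Rightarrow> 'a set \<Rightarrow> nat" where
  "boundary_size n A B =
     card A * (n - card A) + card B * (n - card B) + card ((A - B) \<union> (B - A))"

lemma card_edge_boundary:
  assumes "finite N" "A \<subseteq> N" "B \<subseteq> N"
  shows "card (edge_boundary (bunkbed_edges N) (two_layers A B)) = boundary_size (card N) A B"
proof -
  let ?h = "\<lambda>i (x, y). {(x, i :: nat), (y, i)}"
  \<comment> \<open>Horizontal boundary edges are listed from the inner to the outer end, which
    makes \<open>?h 0\<close> and \<open>?h 1\<close> injective on these products.\<close>
  define S T V where "S = ?h 0 ` (A \<times> (N - A))" and "T = ?h 1 ` (B \<times> (N - B))"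
    and "V = vertical ((A - B) \<union> (B - A))"
  have "edge_boundary (bunkbed_edges N) (two_layers A B) \<subseteq> S \<union> T \<union> V"
  proof
    fix e assume "e \<in> edge_boundary (bunkbed_edges N) (two_layers A B)"
    then obtain x i y j where e: "e = {(x, i), (y, j)}" "{(x, i), (y, j)} \<in> bunkbed_edges N"
        "(x, i) \<in> two_layers A B" "(y, j) \<notin> two_layers A B"
      by (force simp: edge_boundary_def)
    then consider "x \<noteq> y" "i = j" "i = 0" | "x \<noteq> y" "i = j" "i = 1"
      | "x = y" "i = 0" "j = 1" | "x = y" "i = 1" "j = 0"
      by (auto simp: doubleton_in_bunkbed_edges_iff doubleton_eq_iff)
    then show "e \<in> S \<union> T \<union> V"
    proof cases
      case 1
      with e have "e = ?h 0 (x, y)" "(x, y) \<in> A \<times> (N - A)"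
        by (simp_all add: doubleton_in_bunkbed_edges_iff two_layers_def)
      then show ?thesis unfolding S_def by blast
    next
      case 2
      with e have "e = ?h 1 (x, y)" "(x, y) \<in> B \<times> (N - B)"
        by (simp_all add: doubleton_in_bunkbed_edges_iff two_layers_def)
      then show ?thesis unfolding T_def by blast
    next
      case 3
      with e have "e = {(x, 0), (x, 1)}" "x \<in> A - B"
        by (simp_all add: two_layers_def)
      then show ?thesis unfolding V_def vertical_def by blast
    next
      case 4
      with e have "e = {(x, 0), (x, 1)}" "x \<in> B - A"
        by (simp_all add: two_layers_def insert_commute)
      then show ?thesis unfolding V_def vertical_def by blast
    qed
  qed
  moreover have "S \<union> T \<union> V \<subseteq> edge_boundary (bunkbed_edges N) (two_layers A B)"
  proof
    fix e assume "e \<in> S \<union> T \<union> V"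
    then consider x y where "e = {(x, 0), (y, 0)}" "x \<in> A" "y \<in> N - A"
      | x y where "e = {(x, 1), (y, 1)}" "x \<in> B" "y \<in> N - B"
      | x where "e = {(x, 0), (x, 1)}" "x \<in> A - B"
      | x where "e = {(x, 1), (x, 0)}" "x \<in> B - A"
      unfolding S_def T_def V_def vertical_def by (auto simp: insert_commute)
    then obtain x i y j where "e = {(x, i), (y, j)}" "{(x, i), (y, j)} \<in> bunkbed_edges N"
        "(x, i) \<in> two_layers A B" "(y, j) \<notin> two_layers A B"
    proof cases
      case (1 x y)
      then show ?thesis
        using assms by (intro that [of x 0 y 0]) (auto simp: doubleton_in_bunkbed_edges_iff two_layers_def)
    next
      case (2 x y)
      then show ?thesis
        using assms by (intro that [of x 1 y 1]) (auto simp: doubleton_in_bunkbed_edges_iff two_layers_def)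
    next
      case (3 x)
      then show ?thesis
        using assms by (intro that [of x 0 x 1]) (auto simp: doubleton_in_bunkbed_edges_iff two_layers_def)
    next
      case (4 x)
      then show ?thesis
        using assms by (intro that [of x 1 x 0]) (auto simp: doubleton_in_bunkbed_edges_iff two_layers_def)
    qed
    then show "e \<in> edge_boundary (bunkbed_edges N) (two_layers A B)"
      unfolding edge_boundary_def by blast
  qed
  ultimately have eq: "edge_boundary (bunkbed_edges N) (two_layers A B) = S \<union> T \<union> V" ..
  have fin: "finite A" "finite B"
    using assms finite_subset by auto
  have "inj_on (?h 0) (A \<times> (N - A))" "inj_on (?h 1) (B \<times> (N - B))"
    by (auto simp: inj_on_def doubleton_eq_iff)
  then have cardST: "card S = card A * (card N - card A)" "card T = card B * (card N - card B)"
    unfolding S_def T_def using assms fin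
    by (simp_all add: card_image card_cartesian_product card_Diff_subset)
  have finST: "finite S" "finite T" "finite V"
    using assms fin by (simp_all add: S_def T_def V_def vertical_def)
  have S: "snd ` e = {0}" if "e \<in> S" for e
    using that by (auto simp: S_def)
  have T: "snd ` e = {1}" if "e \<in> T" for e
    using that by (auto simp: T_def)
  have V: "snd ` e = {0, 1}" if "e \<in> V" for e
    using that by (auto simp: V_def vertical_def)
  have disj: "S \<inter> T = {}" "S \<inter> V = {}" "T \<inter> V = {}"
    by (rule disjoint_by_layers [OF S T] disjoint_by_layers [OF S V] disjoint_by_layers [OF T V]; auto)+
  then have "(S \<union> T) \<inter> V = {}"
    by blast
  then have card_union: "card (S \<union> T \<union> V) = card S + card T + card V"
    using finST disj(1) by (metis card_Un_disjoint finite_UnI)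
  have "card V = card ((A - B) \<union> (B - A))"
    by (simp only: V_def card_vertical)
  then show ?thesis
    by (simp only: eq card_union cardST boundary_size_def)
qed

section \<open>Upper and lower bounds for the probability of a cluster\<close>

definition cluster_prob :: "'a set \<Rightarrow> real \<Rightarrow> 'a set \<Rightarrow> 'a set \<Rightarrow> real" where
  "cluster_prob N p A B = measure_pmf.prob (bernoulli_product (bunkbed_edges N) p)
     (cluster_event (bunkbed_edges N) (two_layers A B))"

text \<open>Layers are joined by vertical edges only, and one with both ends in the cluster stands
  over a point of \<open>A \<inter> B\<close>. If all of these were closed, the cluster of a bottom
  point could never leave the bottom layer, although it contains a top point.\<close>

lemma vertical_edge_open:
  assumes "\<omega> \<in> cluster_event (bunkbed_edges N) (two_layers A B)" "A \<noteq> {}" "B \<noteq> {}"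
  shows "\<exists>e\<in>vertical (A \<inter> B). \<omega> e"
proof (rule ccontr)
  assume closed: "\<not> ?thesis"
  let ?R = "open_steps (bunkbed_edges N) \<omega>"
  from assms obtain a b where ab: "a \<in> A" "b \<in> B" by blast
  then have "(a, 0) \<in> two_layers A B"
    by (simp add: two_layers_def)
  then have cl: "?R\<^sup>* `` {(a, 0)} = two_layers A B"
    using assms(1) by (simp add: cluster_event_iff)
  have "z \<in> A \<times> {0}" if "((a, 0), z) \<in> ?R\<^sup>*" for z
    using that
  proof (induction rule: rtrancl_induct)
    case base
    then show ?case using ab by simp
  next
    case (step w z)
    then have "((a, 0), z) \<in> ?R\<^sup>*"
      by (auto intro: rtrancl_into_rtrancl)
    then have z: "z \<in> two_layers A B"
      using cl by blast
    obtain x y j where [simp]: "w = (x, 0)" "z = (y, j)" and "x \<in> A"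
      using step.IH by (cases z) auto
    show ?case
    proof (rule ccontr)
      assume "z \<notin> A \<times> {0}"
      then have "j = 1" "y \<in> B"
        using z by (auto simp: two_layers_def)
      moreover have "x = y"
        using step.hyps \<open>j = 1\<close> by (auto simp: open_steps_def doubleton_in_bunkbed_edges_iff)
      moreover have "\<omega> {w, z}"
        using step.hyps by (auto simp: open_steps_def)
      ultimately show False
        using closed \<open>x \<in> A\<close> by (auto simp: vertical_def)
    qed
  qed
  moreover have "((a, 0), (b, 1)) \<in> ?R\<^sup>*"
    using cl ab by (auto simp: two_layers_def)
  ultimately show False by auto
qed

text \<open>All points are joined to the lower end \<open>(c, 0)\<close> of one open vertical edge,
  those of the top layer by way of \<open>(c, 1)\<close>.\<close>

lemma connects_two_layers:
  assumes "A \<subseteq> N" "B \<subseteq> N" "\<exists>e\<in>vertical (A \<inter> B). \<omega> e"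
    "\<omega> \<in> connects (complete_edges (A \<times> {0})) (A \<times> {0})"
    "\<omega> \<in> connects (complete_edges (B \<times> {1})) (B \<times> {1})"
  shows "\<omega> \<in> connects (bunkbed_edges N) (two_layers A B)"
proof -
  let ?R = "open_steps (bunkbed_edges N) \<omega>"
  have sub: "complete_edges (A \<times> {0}) \<subseteq> bunkbed_edges N" "complete_edges (B \<times> {1}) \<subseteq> bunkbed_edges N"
    by (simp_all add: complete_edges_layer_subset assms(1,2))
  note mono = rtrancl_mono [OF open_steps_mono [of _ "bunkbed_edges N" \<omega> \<omega>]]
  from assms(3) obtain c where c: "c \<in> A" "c \<in> B" "\<omega> {(c, 0), (c, 1)}"
    by (auto simp: vertical_def)
  have A: "(z, (c, 0)) \<in> ?R\<^sup>*" if "z \<in> A \<times> {0}" for z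
    using assms(4) mono [OF sub(1)] that c by (auto simp: connects_def)
  have B: "(z, (c, 1)) \<in> ?R\<^sup>*" if "z \<in> B \<times> {1}" for z
    using assms(5) mono [OF sub(2)] that c by (auto simp: connects_def)
  have "((c, 1), (c, 0)) \<in> ?R"
    using c assms(1) by (auto simp: open_steps_def doubleton_in_bunkbed_edges_iff insert_commute)
  then have "(z, (c, 0)) \<in> ?R\<^sup>*" if "z \<in> B \<times> {1}" for z
    using B [OF that] by (rule rtrancl_into_rtrancl [rotated])
  with A have to_c: "(z, (c, 0)) \<in> ?R\<^sup>*" if "z \<in> two_layers A B" for z
    using that unfolding two_layers_def by blast
  have "(z, w) \<in> ?R\<^sup>*" if "z \<in> two_layers A B" "w \<in> two_layers A B" for z w
    using to_c [OF that(1)] to_c [OF that(2)] sym_open_steps_rtrancl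
    by (meson rtrancl_trans symD)
  then show ?thesis
    by (simp add: connects_def)
qed

lemma depends_on_all_closed: "depends_on {\<omega>. \<forall>e\<in>S. \<not> \<omega> e} S"
  and depends_on_some_open: "depends_on {\<omega>. \<exists>e\<in>S. \<omega> e} S"
  by (auto simp: depends_on_def)

lemma vertical_disjoint_boundary:
  "vertical (A \<inter> B) \<inter> edge_boundary E (two_layers A B) = {}"
proof -
  have "e \<subseteq> two_layers A B" if "e \<in> vertical (A \<inter> B)" for e
    using that by (auto simp: vertical_def two_layers_def)
  then show ?thesis
    using edge_boundary_not_subset by blast
qed

text \<open>An open vertical edge inside and a closed boundary are both necessary. They concern
  disjoint sets of edges, so their probabilities multiply.\<close>

lemma cluster_prob_le:
  fixes p :: real
  assumes "finite N" "A \<subseteq> N" "B \<subseteq> N" "A \<noteq> {}" "B \<noteq> {}" "0 \<le> p" "p \<le> 1"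
  shows "cluster_prob N p A B
           \<le> (1 - (1 - p) ^ card (A \<inter> B)) * (1 - p) ^ boundary_size (card N) A B"
proof -
  let ?E = "bunkbed_edges N"
  let ?M = "bernoulli_product ?E p"
  let ?D = "edge_boundary ?E (two_layers A B)"
  have fin: "finite ?E"
    using assms by (simp add: finite_bunkbed_edges)
  have V: "vertical (A \<inter> B) \<subseteq> ?E"
    using assms by (auto simp: vertical_def doubleton_in_bunkbed_edges_iff)
  have D: "?D \<subseteq> ?E"
    by (auto simp: edge_boundary_def)
  have "cluster_event ?E (two_layers A B)
      \<subseteq> {\<omega>. \<exists>e\<in>vertical (A \<inter> B). \<omega> e} \<inter> {\<omega>. \<forall>e\<in>?D. \<not> \<omega> e}"
    using vertical_edge_open assms(4,5) cluster_event_boundary_closed by blast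
  then have "cluster_prob N p A B
      \<le> measure_pmf.prob ?M ({\<omega>. \<exists>e\<in>vertical (A \<inter> B). \<omega> e} \<inter> {\<omega>. \<forall>e\<in>?D. \<not> \<omega> e})"
    unfolding cluster_prob_def
    by (rule measure_pmf.finite_measure_mono) simp
  also have "\<dots> = measure_pmf.prob ?M {\<omega>. \<exists>e\<in>vertical (A \<inter> B). \<omega> e}
      * measure_pmf.prob ?M {\<omega>. \<forall>e\<in>?D. \<not> \<omega> e}"
    by (rule prob_Pi_pmf_Int_indep [OF fin depends_on_some_open depends_on_all_closed
          vertical_disjoint_boundary V])
  also have "\<dots> = (1 - (1 - p) ^ card (A \<inter> B)) * (1 - p) ^ boundary_size (card N) A B"
    using prob_some_open [OF fin V] prob_all_closed [OF fin D] assms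
    by (simp add: card_vertical card_edge_boundary)
  finally show ?thesis .
qed

text \<open>Four events on disjoint edge sets suffice: an open vertical edge, a closed boundary, and
  each layer connected by its own edges. The last two have probability at least 1/2 each, whence the
  4. For disjoint \<open>A\<close> and \<open>B\<close> the bound is 0, so empty layers do no
  harm.\<close>

lemma cluster_prob_ge:
  fixes p :: real
  assumes "finite N" "A \<subseteq> N" "B \<subseteq> N" "1/2 \<le> p" "p \<le> 1"
  shows "(1 - (1 - p) ^ card (A \<inter> B)) * (1 - p) ^ boundary_size (card N) A B / 4
           \<le> cluster_prob N p A B"
proof -
  let ?E = "bunkbed_edges N"
  let ?M = "bernoulli_product ?E p"
  let ?D = "edge_boundary ?E (two_layers A B)" and ?V = "vertical (A \<inter> B)"
  let ?KA = "complete_edges (A \<times> {0 :: nat})" and ?KB = "complete_edges (B \<times> {1 :: nat})"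
  let ?closed = "{\<omega>. \<forall>e\<in>?D. \<not> \<omega> e}" and ?open = "{\<omega>. \<exists>e\<in>?V. \<omega> e}"
    and ?CA = "connects ?KA (A \<times> {0})" and ?CB = "connects ?KB (B \<times> {1})"
  have fin: "finite ?E"
    using assms by (simp add: finite_bunkbed_edges)
  have V: "?V \<subseteq> ?E" and D: "?D \<subseteq> ?E"
    using assms(2) by (auto simp: vertical_def doubleton_in_bunkbed_edges_iff edge_boundary_def)
  have K: "?KA \<subseteq> ?E" "?KB \<subseteq> ?E"
    by (simp_all add: complete_edges_layer_subset assms(2,3))
  have inside: "e \<subseteq> two_layers A B" if "e \<in> ?KA \<union> ?KB \<union> ?V" for e
    using that by (auto simp: complete_edges_def vertical_def two_layers_def)
  have KA: "snd ` e = {0}" if "e \<in> ?KA" for e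
    using that by (auto simp: complete_edges_def)
  have KB: "snd ` e = {1}" if "e \<in> ?KB" for e
    using that by (auto simp: complete_edges_def)
  have V': "snd ` e = {0, 1}" if "e \<in> ?V" for e
    using that by (auto simp: vertical_def)
  have "?V \<inter> ?KA = {}" "?V \<inter> ?KB = {}" "?KA \<inter> ?KB = {}"
    by (rule disjoint_by_layers [OF V' KA] disjoint_by_layers [OF V' KB]
          disjoint_by_layers [OF KA KB]; auto)+
  moreover have "(?KA \<union> ?KB \<union> ?V) \<inter> ?D = {}"
    using inside edge_boundary_not_subset by blast
  ultimately have disj: "?V \<inter> (?KA \<union> (?KB \<union> ?D)) = {}" "?KA \<inter> (?KB \<union> ?D) = {}" "?KB \<inter> ?D = {}"
    by (simp_all add: Int_Un_distrib Int_Un_distrib2)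
  note dep = depends_on_all_closed [of ?D] depends_on_some_open [of ?V]
    depends_on_connects [of ?KA "A \<times> {0}"] depends_on_connects [of ?KB "B \<times> {1}"]
  have half: "1/2 \<le> measure_pmf.prob ?M ?CA" "1/2 \<le> measure_pmf.prob ?M ?CB"
    using fin K assms by (intro prob_connects_complete_edges_ge_half; simp)+
  have "1/4 \<le> measure_pmf.prob ?M ?CA * measure_pmf.prob ?M ?CB"
    using mult_mono [OF half] by simp
  then have "measure_pmf.prob ?M ?open * measure_pmf.prob ?M ?closed * (1/4)
      \<le> measure_pmf.prob ?M ?open * measure_pmf.prob ?M ?closed
        * (measure_pmf.prob ?M ?CA * measure_pmf.prob ?M ?CB)"
    by (intro mult_left_mono) auto
  also have "\<dots> = measure_pmf.prob ?M ?open
      * (measure_pmf.prob ?M ?CA * (measure_pmf.prob ?M ?CB * measure_pmf.prob ?M ?closed))"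
    by (simp only: mult_ac)
  \<comment> \<open>The events are split off one at a time; each fact in \<open>disj\<close>
    separates the edges of one event from those of all events to its right.\<close>
  also have "\<dots> = measure_pmf.prob ?M (?open \<inter> (?CA \<inter> (?CB \<inter> ?closed)))"
    by (simp only: prob_Pi_pmf_Int_indep [OF fin dep(4) dep(1) disj(3) K(2)]
        prob_Pi_pmf_Int_indep [OF fin dep(3) depends_on_Int [OF dep(4) dep(1)] disj(2) K(1)]
        prob_Pi_pmf_Int_indep [OF fin dep(2)
          depends_on_Int [OF dep(3) depends_on_Int [OF dep(4) dep(1)]] disj(1) V])
  also have "\<dots> \<le> cluster_prob N p A B"
  proof -
    have "?open \<inter> (?CA \<inter> (?CB \<inter> ?closed)) \<subseteq> cluster_event ?E (two_layers A B)"
      using cluster_eventI connects_two_layers [OF assms(2,3)] by blast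
    then show ?thesis
      unfolding cluster_prob_def by (rule measure_pmf.finite_measure_mono) simp
  qed
  finally show ?thesis
    using prob_some_open [OF fin V, of p] prob_all_closed [OF fin D, of p]
      card_edge_boundary [OF assms(1-3)] assms(4,5)
    by (simp add: card_vertical)
qed

section \<open>The exchange inequality\<close>

lemma rtrancl_inv_image_involution:
  assumes "\<And>x. \<phi> (\<phi> x) = x"
  shows "(x, y) \<in> (inv_image R \<phi>)\<^sup>* \<longleftrightarrow> (\<phi> x, \<phi> y) \<in> R\<^sup>*"
proof
  show "(\<phi> x, \<phi> y) \<in> R\<^sup>*" if "(x, y) \<in> (inv_image R \<phi>)\<^sup>*"
    using that by (induction rule: rtrancl_induct) (auto intro: rtrancl_into_rtrancl)
  have "(\<phi> a, \<phi> b) \<in> (inv_image R \<phi>)\<^sup>*" if "(a, b) \<in> R\<^sup>*" for a b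
    using that
  proof (induction rule: rtrancl_induct)
    case (step b c)
    then have "(\<phi> b, \<phi> c) \<in> inv_image R \<phi>"
      by (simp add: assms)
    with step.IH show ?case
      by (rule rtrancl_into_rtrancl)
  qed simp
  then show "(x, y) \<in> (inv_image R \<phi>)\<^sup>*" if "(\<phi> x, \<phi> y) \<in> R\<^sup>*"
    using that assms by metis
qed

text \<open>The involution permutes the edges, so relabelling a configuration along it preserves the
  product measure, and it carries clusters to their images.\<close>

lemma prob_cluster_event_involution:
  assumes "finite E" "\<And>x. \<phi> (\<phi> x) = x" "\<And>e. e \<in> E \<Longrightarrow> \<phi> ` e \<in> E"
  shows "measure_pmf.prob (bernoulli_product E p) (cluster_event E (\<phi> ` C))
           = measure_pmf.prob (bernoulli_product E p) (cluster_event E C)"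
proof -
  have inv: "\<phi> ` \<phi> ` S = S" for S
    by (simp add: image_image assms(2))
  have mem_image: "y \<in> \<phi> ` S \<longleftrightarrow> \<phi> y \<in> S" for y S
    using assms(2) by (metis image_iff)
  have E_iff: "\<phi> ` e \<in> E \<longleftrightarrow> e \<in> E" for e
    using assms(3) inv by metis
  have "bij_betw ((`) \<phi>) E E"
    by (rule bij_betw_byWitness [of _ "(`) \<phi>"]) (use assms(3) inv in auto)
  then have M: "bernoulli_product E p = map_pmf (\<lambda>\<omega>. \<omega> \<circ> (`) \<phi>) (bernoulli_product E p)"
    using assms(1) E_iff by (intro Pi_pmf_bij_betw) auto
  have "\<omega> \<circ> (`) \<phi> \<in> cluster_event E C \<longleftrightarrow> \<omega> \<in> cluster_event E (\<phi> ` C)" for \<omega>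
  proof -
    have "{\<phi> x, \<phi> y} \<in> E \<longleftrightarrow> {x, y} \<in> E" for x y
      using E_iff [of "{x, y}"] by simp
    then have "open_steps E (\<omega> \<circ> (`) \<phi>) = inv_image (open_steps E \<omega>) \<phi>"
      by (auto simp: open_steps_def)
    then have "(open_steps E (\<omega> \<circ> (`) \<phi>))\<^sup>* `` {x} = \<phi> ` ((open_steps E \<omega>)\<^sup>* `` {\<phi> x})" for x
      by (intro set_eqI) (simp add: mem_image rtrancl_inv_image_involution [OF assms(2)])
    moreover have "\<phi> ` S = C \<longleftrightarrow> S = \<phi> ` C" for S
      using inv by metis
    ultimately show ?thesis
      by (simp add: cluster_event_def)
  qed
  then have "(\<lambda>\<omega>. \<omega> \<circ> (`) \<phi>) -` cluster_event E C = cluster_event E (\<phi> ` C)"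
    by auto
  then show ?thesis
    by (subst (2) M) simp
qed

lemma cluster_prob_commute:
  assumes "finite N"
  shows "cluster_prob N p A B = cluster_prob N p B A"
proof -
  \<comment> \<open>A transposition is an involution on all of \<open>nat\<close>;
    \<open>1 - i\<close> with truncated subtraction is not.\<close>
  let ?\<phi> = "apsnd (Transposition.transpose 0 1) :: 'a \<times> nat \<Rightarrow> 'a \<times> nat"
  have "?\<phi> ` (S \<times> {i}) = S \<times> {Transposition.transpose 0 1 i}" for S i
    by force
  then have "?\<phi> ` two_layers B A = two_layers A B"
    by (simp add: two_layers_def image_Un Un_commute)
  moreover have "?\<phi> ` e \<in> bunkbed_edges N" if "e \<in> bunkbed_edges N" for e
    using that by (cases rule: bunkbed_edges_cases)
      (auto simp: doubleton_in_bunkbed_edges_iff insert_commute)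
  moreover have "?\<phi> (?\<phi> z) = z" for z
    by (cases z) simp
  ultimately show ?thesis
    using prob_cluster_event_involution [of "bunkbed_edges N" ?\<phi> p "two_layers B A"] assms
    unfolding cluster_prob_def by (metis finite_bunkbed_edges)
qed

text \<open>The four pairs share the factor \<open>?K\<close> and differ only in the size of the
  boundary. With \<open>d = card A - card B\<close>, both pairs on the left have
  \<open>2 * d + 2\<close> more boundary edges than the first pair on the right, which outweighs the
  loss of 1/4 in the lower bound.\<close>

lemma cluster_prob_exchange_aux:
  fixes p :: real
  assumes "finite M" "u \<notin> M" "v \<notin> M" "u \<noteq> v" "A \<subseteq> M" "B \<subseteq> M" "card B \<le> card A" "1/2 \<le> p" "p \<le> 1"
  defines "N \<equiv> insert u (insert v M)"
  shows "cluster_prob N p (insert u A) (insert v B) + cluster_prob N p (insert v A) (insert u B)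
    \<le> cluster_prob N p (insert u (insert v A)) B + cluster_prob N p A (insert u (insert v B))"
proof -
  let ?q = "1 - p" and ?s = "card ((A - B) \<union> (B - A)) + 2" and ?c = "card (A \<inter> B)"
  let ?K = "1 - ?q ^ ?c"
  have fin: "finite A" "finite B" "finite N"
    using assms finite_subset by auto
  have notin: "u \<notin> A" "v \<notin> A" "u \<notin> B" "v \<notin> B"
    using assms by auto
  obtain d where d: "card A = card B + d"
    using assms(7) le_Suc_ex by blast
  have "card N = card M + 2" "card A \<le> card M"
    using assms by (auto simp: N_def card_mono)
  \<comment> \<open>Writing the sizes with \<open>d\<close> and \<open>k\<close> lets the truncated
    subtractions in \<open>boundary_size\<close> evaluate.\<close>
  then obtain k where k: "card N = card B + d + k + 2"
    using d le_Suc_ex by (metis add.assoc add.commute)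
  have sd: "card (insert u (insert v ((A - B) \<union> (B - A)))) = ?s"
    using fin notin assms(4) by simp
  \<comment> \<open>All four pairs have the same symmetric difference, so their vertical boundaries
    have equal size.\<close>
  have "(insert u A - insert v B) \<union> (insert v B - insert u A) = insert u (insert v ((A - B) \<union> (B - A)))"
    "(insert v A - insert u B) \<union> (insert u B - insert v A) = insert u (insert v ((A - B) \<union> (B - A)))"
    "(insert u (insert v A) - B) \<union> (B - insert u (insert v A)) = insert u (insert v ((A - B) \<union> (B - A)))"
    "(A - insert u (insert v B)) \<union> (insert u (insert v B) - A) = insert u (insert v ((A - B) \<union> (B - A)))"
    using notin assms(4) by auto
  note sym_diff = this [THEN arg_cong [of _ _ card], unfolded sd]
  \<comment> \<open>With \<open>n = card N\<close> and \<open>f a = a * (n - a)\<close>, the excess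
    is a difference of two increments of \<open>f\<close>: from \<open>card B\<close> to
    \<open>card B + 1\<close> it grows by \<open>2 * (d + 1)\<close> more than from
    \<open>card A + 1\<close> to \<open>card A + 2\<close>.\<close>
  have b: "boundary_size (card N) (insert u A) (insert v B)
      = boundary_size (card N) (insert u (insert v A)) B + (2 * d + 2)"
    "boundary_size (card N) (insert v A) (insert u B)
      = boundary_size (card N) (insert u (insert v A)) B + (2 * d + 2)"
    and b0: "d = 0 \<Longrightarrow> boundary_size (card N) A (insert u (insert v B))
      = boundary_size (card N) (insert u (insert v A)) B"
    using notin fin assms(4) unfolding boundary_size_def sym_diff
    by (simp_all add: k d algebra_simps)
  define X where "X = ?K * ?q ^ boundary_size (card N) (insert u (insert v A)) B"
  have X: "0 \<le> X"
    using assms by (simp add: X_def power_le_one)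
  have "insert u A \<inter> insert v B = A \<inter> B" "insert v A \<inter> insert u B = A \<inter> B"
    "insert u (insert v A) \<inter> B = A \<inter> B" "A \<inter> insert u (insert v B) = A \<inter> B"
    using notin assms(4) by auto
  note int = this
  have sub: "insert u A \<subseteq> N" "insert v A \<subseteq> N" "insert u B \<subseteq> N" "insert v B \<subseteq> N"
      "insert u (insert v A) \<subseteq> N" "insert u (insert v B) \<subseteq> N" "A \<subseteq> N" "B \<subseteq> N"
    using assms by (auto simp: N_def)
  have p: "0 \<le> p" "p \<le> 1"
    using assms by auto
  have mid: "cluster_prob N p (insert u A) (insert v B) \<le> X * ?q ^ (2 * d + 2)"
    "cluster_prob N p (insert v A) (insert u B) \<le> X * ?q ^ (2 * d + 2)"
    using cluster_prob_le [OF fin(3) sub(1,4) insert_not_empty insert_not_empty p]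
      cluster_prob_le [OF fin(3) sub(2,3) insert_not_empty insert_not_empty p]
    unfolding int b X_def power_add by (simp_all add: mult.assoc)
  have outer: "X / 4 \<le> cluster_prob N p (insert u (insert v A)) B"
    using cluster_prob_ge [OF fin(3) sub(5,8) assms(8,9)] unfolding int X_def .
  have q: "0 \<le> ?q" "?q \<le> 1/2"
    using assms by auto
  show ?thesis
  proof (cases "d = 0")
    \<comment> \<open>The balanced case needs both terms on the right, as only q^2 is gained; otherwise the first
      suffices.\<close>
    case True
    have "X / 4 \<le> cluster_prob N p A (insert u (insert v B))"
      using cluster_prob_ge [OF fin(3) sub(7,6) assms(8,9)] unfolding int X_def b0 [OF True] .
    moreover have "?q ^ (2 * d + 2) \<le> 1/4"
      using power_mono [OF q(2,1), of 2] True by (simp add: power2_eq_square)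
    then have "X * ?q ^ (2 * d + 2) \<le> X * (1/4)"
      using X by (rule mult_left_mono)
    ultimately show ?thesis
      using mid outer by simp
  next
    case False
    have "?q ^ (2 * d + 2) \<le> ?q ^ 4"
      using False q by (intro power_decreasing) auto
    also have "\<dots> \<le> 1/16"
      using power_mono [OF q(2,1), of 4] by (simp add: power_divide)
    finally have "X * ?q ^ (2 * d + 2) \<le> X * (1/16)"
      using X by (rule mult_left_mono)
    moreover have "0 \<le> cluster_prob N p A (insert u (insert v B))"
      by (simp add: cluster_prob_def)
    ultimately show ?thesis
      using mid outer X by simp
  qed
qed

text \<open>Interchanging the layers turns the inequality for \<open>A\<close> and \<open>B\<close>
  into the one for \<open>B\<close> and \<open>A\<close>, so the larger set may be taken in the
  bottom layer.\<close>

lemma cluster_prob_exchange: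
  fixes p :: real
  assumes "finite M" "u \<notin> M" "v \<notin> M" "u \<noteq> v" "A \<subseteq> M" "B \<subseteq> M" "1/2 \<le> p" "p \<le> 1"
  defines "N \<equiv> insert u (insert v M)"
  shows "cluster_prob N p (insert u A) (insert v B) + cluster_prob N p (insert v A) (insert u B)
    \<le> cluster_prob N p (insert u (insert v A)) B + cluster_prob N p A (insert u (insert v B))"
proof (cases "card B \<le> card A")
  case True
  then show ?thesis
    using cluster_prob_exchange_aux [OF assms(1-6)] assms by simp
next
  case False
  have "finite N"
    using assms by simp
  then have "cluster_prob N p S T = cluster_prob N p T S" for S T
    by (rule cluster_prob_commute)
  with False show ?thesis
    using cluster_prob_exchange_aux [OF assms(1-4,6,5) _ assms(7,8)] unfolding N_def
    by (smt (verit) nle_le)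
qed

section \<open>Summation over all clusters\<close>

lemma sum_Pow_insert:
  fixes f :: "'a set \<Rightarrow> 'b :: comm_monoid_add"
  assumes "finite M" "x \<notin> M"
  shows "(\<Sum>A\<in>Pow (insert x M). f A) = (\<Sum>A\<in>Pow M. f A + f (insert x A))"
proof -
  have "inj_on (insert x) (Pow M)"
    using assms(2) by (auto simp: inj_on_def)
  moreover have "Pow M \<inter> insert x ` Pow M = {}"
    using assms(2) by auto
  ultimately show ?thesis
    using assms(1) by (simp add: Pow_insert sum.union_disjoint sum.reindex sum.distrib)
qed

text \<open>Sorting sets by which of \<open>u\<close> and \<open>v\<close> they contain, once for
  each layer, leaves sums over subsets of \<open>M\<close>, where the exchange inequality
  applies.\<close>

lemma sum_Pow_insert2:
  fixes f :: "'a set \<Rightarrow> 'b :: comm_monoid_add"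
  assumes "finite M" "u \<notin> M" "v \<notin> M" "u \<noteq> v"
  shows "(\<Sum>A\<in>Pow (insert u (insert v M)). f A)
    = (\<Sum>A\<in>Pow M. f A + f (insert u A) + (f (insert v A) + f (insert u (insert v A))))"
  using assms by (simp add: sum_Pow_insert)

lemma prob_connected_bunkbed:
  assumes "finite N" "x \<in> N" "y \<in> N"
  shows "measure_pmf.prob (percolation (bunkbed (N, complete_edges N)) p)
      (connected_event (bunkbed (N, complete_edges N)) (x, 0) (y, j))
    = (\<Sum>A\<in>Pow N. \<Sum>B\<in>Pow N. of_bool (x \<in> A) * of_bool ((y, j) \<in> two_layers A B)
         * cluster_prob N p A B)"
proof -
  let ?G = "bunkbed (N, complete_edges N)"
  let ?F = "\<lambda>C. of_bool ((x, 0) \<in> C) * of_bool ((y, j) \<in> C)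
         * measure_pmf.prob (percolation ?G p) (cluster_event (edges ?G) C)"
  have "measure_pmf.prob (percolation ?G p) (connected_event ?G (x, 0) (y, j))
      = (\<Sum>C\<in>Pow (N \<times> {0, 1}). ?F C)"
    using assms finite_bunkbed_edges [of N] bunkbed_edges_subset [of _ N]
    by (intro prob_connected_event_eq_sum) (auto simp: bunkbed_edges_def)
  also have "\<dots> = (\<Sum>(A, B)\<in>Pow N \<times> Pow N. ?F (two_layers A B))"
  proof -
    have "two_layers {x. (x, 0) \<in> C} {x. (x, 1) \<in> C} = C" if "C \<in> Pow (N \<times> {0, 1})" for C
      using that by (auto simp: two_layers_def)
    then show ?thesis
      by (intro sum.reindex_bij_witness [where i = "\<lambda>(A, B). two_layers A B"
            and j = "\<lambda>C. ({x. (x, 0) \<in> C}, {x. (x, 1) \<in> C})"])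
         (simp_all, auto simp: two_layers_def)
  qed
  also have "\<dots> = (\<Sum>A\<in>Pow N. \<Sum>B\<in>Pow N. of_bool (x \<in> A) * of_bool ((y, j) \<in> two_layers A B)
         * cluster_prob N p A B)"
    unfolding sum.cartesian_product [symmetric]
    by (intro sum.cong refl) (simp add: cluster_prob_def percolation_def bunkbed_edges_def two_layers_def)
  finally show ?thesis .
qed

theorem theorem1p1:
  fixes n :: nat and G :: "(nat \<times> nat) ugraph" and u v :: "nat \<times> nat" and p :: real
  assumes "n \<ge> 1"
    and "G = bunkbed (complete_ugraph n)"
    and "u \<in> vertices G" and "snd u = 0"
    and "v \<in> vertices G" and "snd v = 0"
    and "p \<in> {1/2..1}"
  shows "measure_pmf.prob (percolation G p) (connected_event G u v)
           \<ge> measure_pmf.prob (percolation G p) (connected_event G u (symmetrical v))"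
proof (cases "u = v")
  \<comment> \<open>Here the left-hand event is sure; the exchange inequality needs two distinct
    points.\<close>
  case True
  then show ?thesis
    by (simp add: connected_event_refl)
next
  case False
  obtain x y where u: "u = (x, 0)" and v: "v = (y, 0)"
    using assms(4,6) by (metis prod.collapse)
  define M where "M = {1..n} - {x, y}"
  let ?N = "insert x (insert y M)"
  have xy: "x \<in> {1..n}" "y \<in> {1..n}" "x \<noteq> y"
    using assms(2,3,5) False by (auto simp: u v bunkbed_def complete_ugraph_def)
  then have N: "{1..n} = ?N"
    by (auto simp: M_def)
  have M: "finite M" "x \<notin> M" "y \<notin> M"
    by (auto simp: M_def)
  have G: "G = bunkbed (?N, complete_edges ?N)"
    using assms(2) by (simp only: complete_ugraph_def complete_edges_def N)
  let ?w = "cluster_prob ?N p"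
  let ?S = "\<lambda>f. \<Sum>A\<in>Pow M. \<Sum>B\<in>Pow M. f A B :: real"
  have commute: "?w A B = ?w B A" for A B
    using M(1) by (intro cluster_prob_commute) simp
  have conn: "measure_pmf.prob (percolation G p) (connected_event G (x, 0) (y, j))
      = (\<Sum>A\<in>Pow ?N. \<Sum>B\<in>Pow ?N. of_bool (x \<in> A) * of_bool ((y, j) \<in> two_layers A B) * ?w A B)" for j
    unfolding G using M(1) by (intro prob_connected_bunkbed) auto
  have notin: "x \<notin> A" "y \<notin> A" if "A \<subseteq> M" for A
    using that M by auto
  \<comment> \<open>Of the sixteen ways to place \<open>x\<close> and \<open>y\<close> in the two
    layers, the indicators keep the four with both in the bottom set; in \<open>opposite\<close>
    they keep \<open>x\<close> in the bottom and \<open>y\<close> in the top set. The last two terms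
    of the two sums agree.\<close>
  have same: "measure_pmf.prob (percolation G p) (connected_event G (x, 0) (y, 0))
      = ?S (\<lambda>A B. ?w (insert x (insert y A)) B + ?w (insert x (insert y A)) (insert x B)
          + ?w (insert x (insert y A)) (insert y B) + ?w (insert x (insert y A)) (insert x (insert y B)))"
    unfolding conn
    by (simp add: sum_Pow_insert2 [OF M xy(3)] two_layers_def notin xy(3) xy(3) [symmetric] sum.distrib
        cong: sum.cong_simp)
  have opposite: "measure_pmf.prob (percolation G p) (connected_event G (x, 0) (y, 1))
      = ?S (\<lambda>A B. ?w (insert x A) (insert y B) + ?w (insert x A) (insert x (insert y B))
          + ?w (insert x (insert y A)) (insert y B) + ?w (insert x (insert y A)) (insert x (insert y B)))"
    unfolding conn
    by (simp add: sum_Pow_insert2 [OF M xy(3)] two_layers_def notin xy(3) xy(3) [symmetric] sum.distrib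
        cong: sum.cong_simp)
  \<comment> \<open>Swapping the layers and renaming matches the second terms too, so only the first
    terms remain to be compared.\<close>
  have "?S (\<lambda>A B. ?w (insert x A) (insert x (insert y B)))
      = ?S (\<lambda>A B. ?w (insert x (insert y A)) (insert x B))"
    by (subst sum.swap, subst commute, rule refl)
  moreover have "?S (\<lambda>A B. ?w (insert x A) (insert y B)) \<le> ?S (\<lambda>A B. ?w (insert x (insert y A)) B)"
  proof -
    \<comment> \<open>By the same swap each remaining sum equals its mirror image, so the summed
      exchange inequality is twice the claim.\<close>
    have "?S (\<lambda>A B. ?w (insert y A) (insert x B)) = ?S (\<lambda>A B. ?w (insert x A) (insert y B))"
      "?S (\<lambda>A B. ?w A (insert x (insert y B))) = ?S (\<lambda>A B. ?w (insert x (insert y A)) B)"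
      by (subst sum.swap, subst commute, rule refl)+
    moreover have "?S (\<lambda>A B. ?w (insert x A) (insert y B) + ?w (insert y A) (insert x B))
        \<le> ?S (\<lambda>A B. ?w (insert x (insert y A)) B + ?w A (insert x (insert y B)))"
      using M xy(3) assms(7) by (intro sum_mono cluster_prob_exchange) auto
    ultimately show ?thesis
      by (simp add: sum.distrib)
  qed
  ultimately have "measure_pmf.prob (percolation G p) (connected_event G (x, 0) (y, 1))
      \<le> measure_pmf.prob (percolation G p) (connected_event G (x, 0) (y, 0))"
    unfolding same opposite by (simp add: sum.distrib)
  then show ?thesis
    by (simp add: u v symmetrical_def)
qed

end
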